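(* Let $w\in\{0,1\}^{\mathbb{N}}$ be a generalized Morse sequence, $w=b_0\times b_1\times b_2\times\cdots$. Then $w$ has an at most spacer rank-two construction. If the sequence of blocks $(b_i)_{i\in\mathbb{N}}$ is periodic, then $w$ is a fixed point of a substitution.
   Context: Generalized Morse sequences: for a finite binary word $a$, let $a^c$ be the word obtained by exchanging $0$s and $1$s. For finite words $a,b$, $a\times b$ is the concatenation of copies of $a$ and $a^c$ obtained from $b$ by replacing each $0$ in $b$ with $a$ and each $1$ in $b$ with $a^c$ (e.g. $01\times010=011001$). A generalized Morse sequence is an infinite word $w\in\{0,1\}^{\mathbb{N}}$ that can be written $w=b_0\times b_1\times b_2\times\cdots$, where each $b_i$ (a block) is a finite word beginning with $0$; the infinite product is the limit of the words $b_0\times b_1\times\cdots\times b_k$, each of which is an initial segment of the next. Substitutions: a substitution is a function $\zeta:\{0,1\}\to\{0,1\}^{<\mathbb{N}}$ (values in finite words), extended to words by concatenation, such that $\zeta(0)$ starts with $0$ and has length greater than $1$, and $\lim_{n\to\infty}|\zeta^n(1)|=\infty$. A fixed point of $\zeta$ is an infinite word $u$ starting with $0$ with $\zeta(u)=u$. Building: $\mathbb{N}$ is the set of nonnegative integers; $\mathcal{F}$ is the set of all finite words that start and end with $0$; $1^a$ is $a$ consecutive $1$s. For finite $S\subset\mathcal{F}$, a finite word $w$ is built from $S$ if $w=v_11^{a_1}v_21^{a_2}\cdots v_k1^{a_k}v_{k+1}$ for some $k\ge 1$, $v_i\in S$, $a_i\in\mathbb{N}$; it is built from $S$ starting with $u$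 if moreover one can take $v_1=u$. An infinite word $V$ has an at most spacer rank-two construction if there are finite sets $S_i=\{v_{i,1},\dots,v_{i,n_i}\}\subset\mathcal{F}$ ($i\in\mathbb{N}$) with $1\le n_i\le 2$ such that: $v_{0,j}=0$ for all $j$; $v_{i+1,1}$ is built from $S_i$ starting with $v_{i,1}$; $v_{i+1,j}$ is built from $S_i$ for all $2\le j\le n_{i+1}$; and $v_{i,1}$ is an initial segment of $V$ for all $i$. *)

theory Defs
  imports Complex_Main "HOL-Library.Z2" "HOL-Library.Stream"
begin

text \<open>
  The alphabet is the two-element type \<^typ>\<open>bit\<close>; finite words are lists and infinite
  words are streams over it.
\<close>

type_synonym word = "bit list"
type_synonym infinite_word = "bit stream"

definition initial_segment :: "word \<Rightarrow> infinite_word \<Rightarrow> bool" where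
  "initial_segment u w \<longleftrightarrow> stake (length u) w = u"


section \<open>Generalized Morse sequences\<close>

definition compl_word :: "word \<Rightarrow> word" where
  "compl_word a = map (\<lambda>x. if x = 0 then 1 else 0) a"

definition word_times :: "word \<Rightarrow> word \<Rightarrow> word" (infixl "\<boxtimes>" 70) where
  "a \<boxtimes> b = concat (map (\<lambda>x. if x = 0 then a else compl_word a) b)"

lemma "[0, 1] \<boxtimes> [0, 1, 0] = [0, 1, 1, 0, 0, 1]"
  by (simp add: word_times_def compl_word_def)

definition is_block :: "word \<Rightarrow> bool" where
  "is_block u \<longleftrightarrow> u \<noteq> [] \<and> hd u = 0"

primrec partial_times :: "(nat \<Rightarrow> word) \<Rightarrow> nat \<Rightarrow> word" where
  "partial_times b 0 = b 0"
| "partial_times b (Suc k) = partial_times b k \<boxtimes> b (Suc k)"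

text \<open>
  The limit of the partial products is an infinite word exactly when their lengths are
  unbounded, that is, when infinitely many blocks have length at least 2. Individual
  blocks of length 1 (that is, the word 0) are allowed.
\<close>

definition Morse_expansion :: "infinite_word \<Rightarrow> (nat \<Rightarrow> word) \<Rightarrow> bool" where
  "Morse_expansion w b \<longleftrightarrow>
     (\<forall>i. is_block (b i)) \<and>
     filterlim (\<lambda>k. length (partial_times b k)) at_top sequentially \<and>
     (\<forall>k. initial_segment (partial_times b k) w)"

definition generalized_Morse :: "infinite_word \<Rightarrow> bool" where
  "generalized_Morse w \<longleftrightarrow> (\<exists>b. Morse_expansion w b)"

definition periodic :: "(nat \<Rightarrow> word) \<Rightarrow> bool" where
  "periodic b \<longleftrightarrow> (\<exists>p>0. \<forall>i. b (i + p) = b i)"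


section \<open>Substitutions\<close>

definition subst_word :: "(bit \<Rightarrow> word) \<Rightarrow> word \<Rightarrow> word" where
  "subst_word \<zeta> u = concat (map \<zeta> u)"

definition substitution :: "(bit \<Rightarrow> word) \<Rightarrow> bool" where
  "substitution \<zeta> \<longleftrightarrow>
     length (\<zeta> 0) > 1 \<and> hd (\<zeta> 0) = 0 \<and>
     filterlim (\<lambda>n. length ((subst_word \<zeta> ^^ n) [1])) at_top sequentially"

text \<open>
  \<^const>\<open>flat\<close> concatenates a stream of words and is meaningful only if these are
  nonempty. This holds for \<^term>\<open>smap \<zeta> u\<close> when \<^term>\<open>substitution \<zeta>\<close>: an empty
  \<^term>\<open>\<zeta> 1\<close> would make every iterate of \<^term>\<open>\<zeta>\<close> on 1 after the zeroth empty.
\<close>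

definition fixed_point :: "(bit \<Rightarrow> word) \<Rightarrow> infinite_word \<Rightarrow> bool" where
  "fixed_point \<zeta> u \<longleftrightarrow> shd u = 0 \<and> flat (smap \<zeta> u) = u"


section \<open>Spacer rank-two constructions\<close>

definition words_F :: "word set" where
  "words_F = {u. u \<noteq> [] \<and> hd u = 0 \<and> last u = 0}"

definition built_as :: "word set \<Rightarrow> nat \<Rightarrow> (nat \<Rightarrow> word) \<Rightarrow> (nat \<Rightarrow> nat) \<Rightarrow> word \<Rightarrow> bool" where
  "built_as S k v a w \<longleftrightarrow>
     k \<ge> 1 \<and> (\<forall>i\<in>{1..k + 1}. v i \<in> S) \<and>
     w = concat (map (\<lambda>i. v i @ replicate (a i) 1) [1..<k + 1]) @ v (k + 1)"

definition built_from :: "word set \<Rightarrow> word \<Rightarrow> bool" where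
  "built_from S w \<longleftrightarrow> (\<exists>k v a. built_as S k v a w)"

definition built_from_starting :: "word set \<Rightarrow> word \<Rightarrow> word \<Rightarrow> bool" where
  "built_from_starting S u w \<longleftrightarrow> (\<exists>k v a. built_as S k v a w \<and> v 1 = u)"

text \<open>
  The set \<open>S\<^sub>i\<close> is presented by the listing \<open>v i 1, \<dots>, v i (n i)\<close>, which may have
  repetitions; values of \<open>v i\<close> outside \<open>{1..n i}\<close> are irrelevant.
\<close>

definition at_most_spacer_rank_two :: "infinite_word \<Rightarrow> bool" where
  "at_most_spacer_rank_two V \<longleftrightarrow>
     (\<exists>(n :: nat \<Rightarrow> nat) (v :: nat \<Rightarrow> nat \<Rightarrow> word).
        (\<forall>i. 1 \<le> n i \<and> n i \<le> 2) \<and>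
        (\<forall>i. v i ` {1..n i} \<subseteq> words_F) \<and>
        (\<forall>j\<in>{1..n 0}. v 0 j = [0]) \<and>
        (\<forall>i. built_from_starting (v i ` {1..n i}) (v i 1) (v (i + 1) 1)) \<and>
        (\<forall>i. \<forall>j\<in>{2..n (i + 1)}. built_from (v i ` {1..n i}) (v (i + 1) j)) \<and>
        (\<forall>i. initial_segment (v i 1) V))"

end

theory Submission
  imports Defs
begin

text \<open>
  The word w is a concatenation of copies of a partial product a and of its complement.
  Stripping the ones at both ends of these two words leaves at most two words starting and
  ending with 0, and the stripped ones become spacers. Passing to a longer partial product
  \<open>a \<boxtimes> c\<close> and stripping again gives words built from the previous two. Since a built word
  needs at least two pieces, the chain starts at [0] and jumps at once to a partial product with
  two zeros and, unless w consists of zeros only, two ones.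

  If b has period p and a is the product of the first p blocks, then \<open>w = a \<boxtimes> w\<close>, that is, w is
  fixed by the substitution sending 0 to a and 1 to the complement of a.
\<close>

section \<open>Products of words\<close>

lemma compl_word_simps [simp]:
  "compl_word [] = []"
  "compl_word (x # a) = (if x = 0 then 1 else 0) # compl_word a"
  "compl_word (a @ b) = compl_word a @ compl_word b"
  by (simp_all add: compl_word_def)

lemma compl_word_compl_word [simp]: "compl_word (compl_word a) = a"
  by (induction a) auto

lemma length_compl_word [simp]: "length (compl_word a) = length a"
  by (simp add: compl_word_def)

lemma zero_in_compl_word_iff [simp]: "0 \<in> set (compl_word a) \<longleftrightarrow> 1 \<in> set a"
  by (induction a) auto

lemma one_in_compl_word_iff [simp]: "1 \<in> set (compl_word a) \<longleftrightarrow> 0 \<in> set a"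
  by (induction a) auto

lemma word_times_simps [simp]:
  "a \<boxtimes> [] = []"
  "a \<boxtimes> (x # b) = (if x = 0 then a else compl_word a) @ a \<boxtimes> b"
  "a \<boxtimes> (b @ c) = a \<boxtimes> b @ a \<boxtimes> c"
  by (simp_all add: word_times_def)

lemma compl_word_times: "compl_word (a \<boxtimes> b) = a \<boxtimes> compl_word b"
  by (induction b) auto

text \<open>A letter 1 of \<open>c\<close> contributes the complement of
  \<open>a \<boxtimes> b\<close>, and complementing a product amounts to complementing its right
  factor.\<close>

lemma word_times_assoc: "a \<boxtimes> b \<boxtimes> c = a \<boxtimes> (b \<boxtimes> c)"
  by (induction c) (auto simp: compl_word_times)

lemma length_word_times [simp]: "length (a \<boxtimes> b) = length a * length b"
  by (induction b) auto

lemma zero_word_times [simp]: "[0] \<boxtimes> b = b"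
  by (induction b) auto

lemma is_block_iff: "is_block a \<longleftrightarrow> (\<exists>a'. a = 0 # a')"
  by (cases a) (auto simp: is_block_def)

lemma is_block_word_times: "is_block a \<Longrightarrow> is_block b \<Longrightarrow> is_block (a \<boxtimes> b)"
  by (auto simp: is_block_iff)

lemma is_block_partial_times:
  assumes "\<And>i. is_block (b i)"
  shows "is_block (partial_times b k)"
  by (induction k) (auto intro: is_block_word_times assms)

text \<open>Associativity lets the blocks after index \<open>k\<close> be multiplied among
  themselves first; \<open>c\<close> is their product.\<close>

lemma partial_times_factor:
  assumes "\<And>i. is_block (b i)" and "k < l"
  shows "\<exists>c. is_block c \<and> partial_times b l = partial_times b k \<boxtimes> c"
  using \<open>k < l\<close>
proof (induction l)
  case (Suc l)
  show ?case
  proof (cases "k = l")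
    case True
    then show ?thesis using assms(1) by auto
  next
    case False
    then obtain c where "is_block c" "partial_times b l = partial_times b k \<boxtimes> c"
      using Suc by auto
    then show ?thesis
      using assms(1)[of "Suc l"] is_block_word_times
      by (intro exI[of _ "c \<boxtimes> b (Suc l)"]) (auto simp: word_times_assoc)
  qed
qed simp


section \<open>Stripping ones from both ends\<close>

definition trim :: "word \<Rightarrow> word" where
  "trim a = rev (dropWhile ((=) 1) (rev (dropWhile ((=) 1) a)))"

lemma dropWhile_replicate_append:
  "dropWhile ((=) x) (replicate m x @ a) = dropWhile ((=) x) a"
  by (induction m) auto

lemma words_F_not_Nil [simp]: "[] \<notin> words_F"
  by (simp add: words_F_def)

lemma dropWhile_words_F: "y \<in> words_F \<Longrightarrow> dropWhile ((=) 1) (y @ z) = y @ z"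
  by (cases y) (auto simp: words_F_def)

text \<open>Since \<open>y\<close> starts and ends with 0, stripping stops exactly at its two ends.
  Hence any padding by ones found around a word of \<open>words_F\<close> already computes the
  trim.\<close>

lemma trim_padded:
  assumes "y \<in> words_F"
  shows "trim (replicate m 1 @ y @ replicate r 1) = y"
proof -
  have "rev y \<in> words_F"
    using assms by (auto simp: words_F_def hd_rev last_rev)
  then have "dropWhile ((=) 1) (rev y) = rev y"
    using dropWhile_words_F[of "rev y" "[]"] by simp
  then show ?thesis
    using assms by (simp add: trim_def dropWhile_replicate_append dropWhile_words_F)
qed

lemma trim_ones [simp]: "trim (replicate m 1) = []"
  by (simp add: trim_def)

lemma padded_decomposition:
  assumes "0 \<in> set a"
  shows "\<exists>m y r. a = replicate m 1 @ y @ replicate r 1 \<and> y \<in> words_F"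
proof -
  obtain p q where pq: "a = p @ 0 # q" "0 \<notin> set p"
    using split_list_first[OF assms] by blast
  \<comment> \<open>Cut at the first and at the last 0. The last 0 is sought in
    \<open>0 # q\<close>, not in \<open>q\<close>, because the first 0 may be the only one.\<close>
  obtain s t where st: "0 # q = s @ 0 # t" "0 \<notin> set t"
    using split_list_last[of 0 "0 # q"] by auto
  have p: "p = replicate (length p) 1" and t: "t = replicate (length t) 1"
    using pq(2) st(2) by (metis bit_not_zero_iff replicate_eqI)+
  have "s @ [0] \<in> words_F"
    using st(1) by (cases s) (auto simp: words_F_def)
  moreover have "a = replicate (length p) 1 @ (s @ [0]) @ replicate (length t) 1"
    using pq(1) st(1) p t by (metis append.assoc append_Cons append_Nil)
  ultimately show ?thesis by blast
qed

lemma no_zero_ones: "0 \<notin> set a \<Longrightarrow> a = replicate (length a) (1 :: bit)"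
  by (metis bit_not_zero_iff replicate_eqI)

lemma trim_eq_Nil_iff: "trim a = [] \<longleftrightarrow> 0 \<notin> set a"
proof (cases "0 \<in> set a")
  case True
  then obtain m y r where "a = replicate m 1 @ y @ replicate r 1" "y \<in> words_F"
    using padded_decomposition by blast
  then show ?thesis using True trim_padded by auto
next
  case False
  then show ?thesis by (metis no_zero_ones trim_ones)
qed

lemma trim_words_F: "0 \<in> set a \<Longrightarrow> trim a \<in> words_F"
  using padded_decomposition trim_padded by metis

lemma trim_split:
  assumes "0 \<in> set a"
  shows "\<exists>m r. a = replicate m 1 @ trim a @ replicate r 1"
  using padded_decomposition[OF assms] trim_padded by metis

text \<open>A block starts with 0, so nothing is stripped in front. This keeps trimmed partial
  products prefixes of w.\<close>

lemma is_block_trim: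
  assumes "is_block a"
  shows "\<exists>r. a = trim a @ replicate r 1"
proof -
  obtain m r where a: "a = replicate m 1 @ trim a @ replicate r 1"
    using assms trim_split[of a] by (auto simp: is_block_iff)
  moreover have "m = 0"
  proof (cases m)
    case (Suc m')
    then have "hd a = 1" using a by (metis append_Cons list.sel(1) replicate_Suc)
    then show ?thesis using assms by (simp add: is_block_def)
  qed
  ultimately show ?thesis by auto
qed


section \<open>Building words\<close>

lemma built_from_starting_pair:
  assumes "u \<in> S" "u' \<in> S"
  shows "built_from_starting S u (u @ replicate m 1 @ u')"
  unfolding built_from_starting_def built_as_def
  using assms by (intro exI[of _ 1] exI[of _ "\<lambda>i. if i = 1 then u else u'"] exI[of _ "\<lambda>_. m"]) auto

lemma built_from_starting_Cons:
  assumes "u \<in> S" "built_from_starting S u' w"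
  shows "built_from_starting S u (u @ replicate m 1 @ w)"
proof -
  obtain k v a where k: "k \<ge> 1" and v: "\<forall>i\<in>{1..k + 1}. v i \<in> S"
    and w: "w = concat (map (\<lambda>i. v i @ replicate (a i) 1) [1..<k + 1]) @ v (k + 1)"
    using assms(2) unfolding built_from_starting_def built_as_def by blast
  \<comment> \<open>The new piece takes position 1 and the old ones move up by one; position 0 is
    never read.\<close>
  define v' where "v' = (\<lambda>i. if i \<le> 1 then u else v (i - 1))"
  define a' where "a' = (\<lambda>i. if i \<le> 1 then m else a (i - 1))"
  have "[1..<Suc k + 1] = 1 # map Suc [1..<k + 1]"
    by (simp add: upt_conv_Cons map_Suc_upt del: upt_Suc)
  then have "u @ replicate m 1 @ w
      = concat (map (\<lambda>i. v' i @ replicate (a' i) 1) [1..<Suc k + 1]) @ v' (Suc k + 1)"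
    using k by (auto simp: w v'_def a'_def o_def simp del: upt_Suc intro!: arg_cong[of _ _ concat])
  moreover have "\<forall>i\<in>{1..Suc k + 1}. v' i \<in> S"
  proof
    fix i assume "i \<in> {1..Suc k + 1}"
    then have "i \<le> 1 \<or> i - 1 \<in> {1..k + 1}" by auto
    then show "v' i \<in> S" using v assms(1) by (auto simp: v'_def)
  qed
  ultimately show ?thesis
    unfolding built_from_starting_def built_as_def
    by (intro exI[of _ "Suc k"] exI[of _ v'] exI[of _ a']) (auto simp: v'_def)
qed

lemma built_from_starting_imp_built_from: "built_from_starting S u w \<Longrightarrow> built_from S w"
  by (auto simp: built_from_starting_def built_from_def)

text \<open>The first piece supplies the leading 0 and the last piece the final 0.\<close>

lemma built_from_words_F:
  assumes "built_from S w" "S \<subseteq> words_F"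
  shows "w \<in> words_F"
proof -
  obtain k v a where k: "k \<ge> 1" and v: "\<forall>i\<in>{1..k + 1}. v i \<in> S"
    and w: "w = concat (map (\<lambda>i. v i @ replicate (a i) 1) [1..<k + 1]) @ v (k + 1)"
    using assms(1) unfolding built_from_def built_as_def by blast
  have "v 1 \<in> words_F" "v (k + 1) \<in> words_F" using v k assms(2) by auto
  moreover have "[1..<k + 1] = 1 # [2..<k + 1]"
    using k by (simp add: upt_conv_Cons numeral_2_eq_2 del: upt_Suc)
  ultimately show ?thesis
    by (auto simp: w words_F_def simp del: upt_Suc)
qed

text \<open>A piece \<open>[1]\<close> stands for a single spacer, every other piece is a word of
  \<open>S\<close>. Building needs at least two words, which forces the separate cases of no word,
  one word and several. Spacers before the first word or after the last one become padding.\<close>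

lemma concat_pieces_padded:
  assumes "set (filter (\<lambda>p. p \<noteq> [1]) ps) \<subseteq> S"
  shows "case filter (\<lambda>p. p \<noteq> [1]) ps of
      [] \<Rightarrow> \<exists>m. concat ps = replicate m 1
    | u # us \<Rightarrow> \<exists>m y r. concat ps = replicate m 1 @ y @ replicate r 1 \<and>
        (if us = [] then y = u else built_from_starting S u y)"
  using assms
proof (induction ps)
  case Nil
  then show ?case by (simp add: exI[of _ 0])
next
  case (Cons p ps)
  let ?us = "filter (\<lambda>p. p \<noteq> [1]) ps"
  show ?case
  proof (cases "p = [1]")
    case True
    show ?thesis
    proof (cases ?us)
      case Nil
      then obtain m where "concat ps = replicate m 1" using Cons by auto
      then show ?thesis using True Nil by (auto intro: exI[of _ "Suc m"])
    next
      case u: (Cons u us)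
      then obtain m y r where "concat ps = replicate m 1 @ y @ replicate r 1"
        "if us = [] then y = u else built_from_starting S u y"
        using Cons True by auto
      then have "concat (p # ps) = replicate (Suc m) 1 @ y @ replicate r 1"
        "if us = [] then y = u else built_from_starting S u y"
        using True by simp_all
      then show ?thesis using True u by (simp only: filter.simps list.case simp_thms if_True if_False) blast
    qed
  next
    case False
    then have p: "p \<in> S" and us: "set ?us \<subseteq> S" using Cons.prems by auto
    show ?thesis
    proof (cases ?us)
      case Nil
      then obtain m where "concat ps = replicate m 1" using Cons us by auto
      then have "concat (p # ps) = replicate 0 1 @ p @ replicate m 1" by simp
      then have "\<exists>m y r. concat (p # ps) = replicate m 1 @ y @ replicate r 1 \<and> y = p" by blast
      then show ?thesis using False Nil by simp
    next
      case u: (Cons u us')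
      then obtain m y r where y: "concat ps = replicate m 1 @ y @ replicate r 1"
        "if us' = [] then y = u else built_from_starting S u y"
        using Cons us by auto
      \<comment> \<open>Ones that were padding in front of \<open>y\<close> now lie between two
        words and become spacers.\<close>
      have "built_from_starting S p (p @ replicate m 1 @ y)"
      proof (cases "us' = []")
        case True
        then show ?thesis using y p us u by (auto intro: built_from_starting_pair)
      next
        case False
        then show ?thesis using y p by (auto intro: built_from_starting_Cons)
      qed
      moreover have "concat (p # ps) = replicate 0 1 @ (p @ replicate m 1 @ y) @ replicate r 1"
        using y by simp
      ultimately have "\<exists>m y r. concat (p # ps) = replicate m 1 @ y @ replicate r 1 \<and>
          built_from_starting S p y" by blast
      then show ?thesis using False u by simp
    qed
  qed
qed

text \<open>A copy consisting only of ones trims to the empty word; it contributes nothing but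
  spacers and is therefore discarded.\<close>

definition cores :: "word \<Rightarrow> word \<Rightarrow> word list" where
  "cores a c = filter (\<lambda>u. u \<noteq> []) (map (\<lambda>x. trim (if x = 0 then a else compl_word a)) c)"

text \<open>These become the words of one level of the construction. If \<open>a\<close> consists of
  zeros, its complement trims to the empty word, and removing that leaves a level with one
  word.\<close>

definition cores_set :: "word \<Rightarrow> word set" where
  "cores_set a = {trim a, trim (compl_word a)} - {[]}"

lemma cores_set_words_F: "cores_set a \<subseteq> words_F"
  by (auto simp: cores_set_def trim_eq_Nil_iff intro: trim_words_F)

lemma set_cores: "set (cores a c) \<subseteq> cores_set a"
  by (auto simp: cores_def cores_set_def)

text \<open>Each stripped 1 is a piece of its own and a nonempty trimmed word is one piece; having
  zero ends, it cannot be mistaken for \<open>[1]\<close>.\<close>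

lemma pieces_of_word:
  "\<exists>ps. concat ps = a \<and> filter (\<lambda>p. p \<noteq> [1]) ps = filter (\<lambda>u. u \<noteq> []) [trim a]"
proof (cases "0 \<in> set a")
  case True
  then obtain m r where a: "a = replicate m 1 @ trim a @ replicate r 1"
    using trim_split by blast
  have "trim a \<noteq> []" "trim a \<noteq> [1]"
    using trim_words_F[OF True] by (auto simp: words_F_def)
  moreover have "concat (replicate n [1]) = replicate n (1 :: bit)" for n
    by (induction n) auto
  ultimately show ?thesis
    using a by (intro exI[of _ "replicate m [1] @ [trim a] @ replicate r [1]"]) (simp add: filter_replicate)
next
  case False
  have "concat (replicate n [1]) = replicate n (1 :: bit)" for n
    by (induction n) auto
  then show ?thesis
    using False no_zero_ones[OF False] trim_eq_Nil_iff[of a]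
    by (intro exI[of _ "replicate (length a) [1]"]) (simp add: filter_replicate)
qed

lemma pieces_of_product:
  "\<exists>ps. concat ps = a \<boxtimes> c \<and> filter (\<lambda>p. p \<noteq> [1]) ps = cores a c"
proof (induction c)
  case Nil
  show ?case by (auto simp: cores_def intro: exI[of _ "[]"])
next
  case (Cons x c)
  obtain ps where "concat ps = a \<boxtimes> c" "filter (\<lambda>p. p \<noteq> [1]) ps = cores a c"
    using Cons by blast
  moreover obtain qs where "concat qs = (if x = 0 then a else compl_word a)"
    "filter (\<lambda>p. p \<noteq> [1]) qs = filter (\<lambda>u. u \<noteq> []) [trim (if x = 0 then a else compl_word a)]"
    using pieces_of_word by blast
  ultimately show ?case
    by (intro exI[of _ "qs @ ps"]) (simp add: cores_def)
qed

lemma built_from_cores: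
  assumes "length (cores a c) \<ge> 2"
  shows "built_from_starting (cores_set a) (hd (cores a c)) (trim (a \<boxtimes> c))"
proof -
  obtain u u' us where us: "cores a c = u # u' # us"
    using assms by (cases "cores a c" rule: remdups_adj.cases) auto
  obtain ps where ps: "concat ps = a \<boxtimes> c" "filter (\<lambda>p. p \<noteq> [1]) ps = cores a c"
    using pieces_of_product by blast
  then obtain m y r where y: "a \<boxtimes> c = replicate m 1 @ y @ replicate r 1"
    "built_from_starting (cores_set a) u y"
    using concat_pieces_padded[of ps "cores_set a"] set_cores[of a c] us by auto
  \<comment> \<open>A word built from words with zero ends has zero ends itself, so \<open>y\<close>
    is the trim of the product.\<close>
  then have "y \<in> words_F"
    using built_from_words_F built_from_starting_imp_built_from cores_set_words_F by blast
  then show ?thesis using y us trim_padded by simp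
qed

text \<open>Only the copies of \<open>a\<close> are sure to contain a 0; if \<open>a\<close> has no
  1, the complemented copies leave no core.\<close>

lemma length_cores_le: "length (filter (\<lambda>x. x = 0) c) \<le> length (cores a c)" if "0 \<in> set a"
  using that by (induction c) (auto simp: cores_def trim_eq_Nil_iff intro: le_SucI)

lemma length_cores: "length (cores a c) = length c" if "0 \<in> set a" "1 \<in> set a"
  using that by (induction c) (auto simp: cores_def trim_eq_Nil_iff)

lemma hd_cores: "hd (cores a c) = trim a" if "is_block a" "is_block c"
  using that by (auto simp: is_block_iff cores_def trim_eq_Nil_iff)


section \<open>Spacer rank-two constructions from chains of products\<close>

text \<open>The condition for one level to follow another. The first count serves the trim of
  \<open>a'\<close>. The second serves the trim of its complement
  \<open>a \<boxtimes> compl_word c\<close>, which yields a word only if \<open>a'\<close> contains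
  a 1.\<close>

definition extends :: "word \<Rightarrow> word \<Rightarrow> bool" where
  "extends a a' \<longleftrightarrow> (\<exists>c. is_block c \<and> a' = a \<boxtimes> c \<and> 2 \<le> length (cores a c) \<and>
     (1 \<in> set a' \<longrightarrow> 2 \<le> length (cores a (compl_word c))))"

lemma spacer_rank_two_from_chain:
  assumes "A 0 = [0]"
    and block: "\<And>i. is_block (A i)"
    and ext: "\<And>i. extends (A i) (A (Suc i))"
    and pre: "\<And>i. initial_segment (A i) w"
  shows "at_most_spacer_rank_two w"
proof -
  define n :: "nat \<Rightarrow> nat" where "n i = (if 1 \<in> set (A i) then 2 else 1)" for i
  define v where "v i j = trim (if j = (1 :: nat) then A i else compl_word (A i))" for i j
  have zero: "0 \<in> set (A i)" for i using block[of i] by (auto simp: is_block_iff)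
  have S: "v i ` {1..n i} = cores_set (A i)" for i
  proof (cases "1 \<in> set (A i)")
    case True
    moreover have "{1..2 :: nat} = {1, 2}" by auto
    ultimately show ?thesis
      using zero[of i] by (auto simp: n_def v_def cores_set_def trim_eq_Nil_iff)
  next
    case False
    then have "trim (compl_word (A i)) = []" by (simp add: trim_eq_Nil_iff)
    then show ?thesis using False zero[of i]
      by (auto simp: n_def v_def cores_set_def trim_eq_Nil_iff)
  qed
  have built1: "built_from_starting (cores_set (A i)) (v i 1) (v (i + 1) 1)" for i
  proof -
    obtain c where "is_block c" "A (Suc i) = A i \<boxtimes> c" "2 \<le> length (cores (A i) c)"
      using ext[of i] by (auto simp: extends_def)
    then show ?thesis
      using built_from_cores[of "A i" c] hd_cores[OF block[of i], of c] by (simp add: v_def)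
  qed
  \<comment> \<open>The complement of \<open>A i \<boxtimes> c\<close> is
    \<open>A i \<boxtimes> compl_word c\<close>, so the second word arises like the first.\<close>
  have built2: "built_from (cores_set (A i)) (v (i + 1) j)" if "j \<in> {2..n (i + 1)}" for i j
  proof -
    have "j = 2" "1 \<in> set (A (Suc i))"
      using that by (auto simp: n_def split: if_splits)
    moreover then obtain c where "A (Suc i) = A i \<boxtimes> c" "2 \<le> length (cores (A i) (compl_word c))"
      using ext[of i] by (auto simp: extends_def)
    ultimately show ?thesis
      using built_from_starting_imp_built_from[OF built_from_cores[of "A i" "compl_word c"]]
      by (simp add: v_def compl_word_times)
  qed
  have seg: "initial_segment (v i 1) w" for i
  proof -
    obtain r where r: "A i = trim (A i) @ replicate r 1"
      using is_block_trim[OF block] by blast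
    have "stake (length (trim (A i))) w = take (length (trim (A i))) (stake (length (A i)) w)"
      by (subst (3) r) (simp add: take_stake min_def)
    also have "\<dots> = take (length (trim (A i))) (A i)"
      using pre[of i] by (simp add: initial_segment_def)
    also have "\<dots> = trim (A i)" by (subst (2) r) simp
    finally show ?thesis by (simp add: v_def initial_segment_def)
  qed
  have "trim [0] = [0]" by (simp add: trim_def)
  then have v0: "\<forall>j\<in>{1..n 0}. v 0 j = [0]" by (auto simp: n_def v_def assms(1))
  have n12: "1 \<le> n i \<and> n i \<le> 2" for i by (simp add: n_def)
  show ?thesis
    unfolding at_most_spacer_rank_two_def
    using v0 built1 built2 seg cores_set_words_F n12
    by (intro exI[of _ n] exI[of _ v]) (simp only: S, blast)
qed

text \<open>Once both letters occur in \<open>a\<close>, every copy of \<open>a\<close> or of its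
  complement has a nonempty core, so the number of cores is the length of the factor.\<close>

lemma extends_one:
  assumes "is_block a" "is_block c" "2 \<le> length c" "1 \<in> set a"
  shows "extends a (a \<boxtimes> c)"
proof -
  have "0 \<in> set a" using assms(1) by (auto simp: is_block_iff)
  then show ?thesis using assms unfolding extends_def by (intro exI[of _ c]) (simp add: length_cores)
qed

lemma generalized_Morse_rank_two:
  assumes "Morse_expansion w b"
  shows "at_most_spacer_rank_two w"
proof -
  let ?P = "partial_times b"
  have block: "is_block (b i)" and seg: "initial_segment (?P i) w" for i
    using assms by (auto simp: Morse_expansion_def)
  have lim: "filterlim (\<lambda>k. length (?P k)) at_top sequentially"
    using assms by (simp add: Morse_expansion_def)
  have Pblock: "is_block (?P k)" for k using is_block_partial_times block by blast
  have longer: "\<exists>l>k. length (?P k) < length (?P l)" for k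
  proof -
    have "\<forall>\<^sub>F l in sequentially. length (?P k) + 1 \<le> length (?P l) \<and> k < l"
      using lim by (auto simp: filterlim_at_top intro!: eventually_conj eventually_gt_at_top)
    then obtain l where "length (?P k) + 1 \<le> length (?P l) \<and> k < l"
      using eventually_happens' sequentially_bot by blast
    then show ?thesis by (intro exI[of _ l]) auto
  qed
  have factor: "\<exists>c. is_block c \<and> ?P l = ?P k \<boxtimes> c \<and> 2 \<le> length c"
    if "k < l" "length (?P k) < length (?P l)" for k l
  proof -
    obtain c where c: "is_block c" "?P l = ?P k \<boxtimes> c"
      using partial_times_factor[of b k l] block \<open>k < l\<close> by blast
    have "2 \<le> length c"
    proof (rule ccontr)
      assume "\<not> 2 \<le> length c"
      then have "length c \<le> 1" by simp
      then have "length (?P k) * length c \<le> length (?P k) * 1" by (rule mult_le_mono2)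
      then show False using that c by simp
    qed
    then show ?thesis using c by blast
  qed
  \<comment> \<open>The first jump. Over \<open>[0]\<close> the cores of a word are its zeros and
    those of its complement are its ones, so two of each are needed as soon as a 1 occurs. By the
    second conjunct, either \<open>?P K\<close> has both letters or no partial product contains a
    1.\<close>
  have ones: "\<exists>K. extends [0] (?P K) \<and> ((\<exists>l. 1 \<in> set (?P l)) \<longrightarrow> 1 \<in> set (?P K))"
  proof (cases "\<exists>l. 1 \<in> set (?P l)")
    case True
    then obtain k where k: "1 \<in> set (?P k)" by blast
    obtain l where l: "k < l" "length (?P k) < length (?P l)" using longer by blast
    obtain c where c: "is_block c" "?P l = ?P k \<boxtimes> c" "2 \<le> length c" using factor[OF l] by blast
    obtain x y c' where c': "c = x # y # c'" using c(3) by (cases c rule: remdups_adj.cases) auto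
    have count: "1 \<le> length (filter (\<lambda>z. z = x) d)" if "x \<in> set d" for x :: bit and d
      using that by (induction d) auto
    have k0: "0 \<in> set (?P k)" using Pblock[of k] by (auto simp: is_block_iff)
    \<comment> \<open>\<open>f x\<close> and \<open>f y\<close> are the first two copies inside
      \<open>?P l\<close>. Each contains both letters, so every letter occurs at least
      twice.\<close>
    define f where "f z = (if z = 0 then ?P k else compl_word (?P k))" for z :: bit
    have f: "z \<in> set (f z')" for z z'
      using k k0 by (cases z) (auto simp: f_def)
    have Pl: "?P l = f x @ f y @ ?P k \<boxtimes> c'" using c(2) c' by (simp add: f_def)
    have two: "2 \<le> length (filter (\<lambda>z. z = z0) (?P l))" for z0
      unfolding Pl filter_append length_append
      using count[OF f[of z0 x]] count[OF f[of z0 y]] by linarith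
    have "length (filter (\<lambda>z. z = 0) (compl_word d)) = length (filter (\<lambda>z. z = 1) d)" for d
      by (induction d) auto
    then have "extends [0] (?P l)"
      unfolding extends_def
      using two[of 0] two[of 1] length_cores_le[of "[0]" "?P l"]
        length_cores_le[of "[0]" "compl_word (?P l)"] Pblock[of l]
      by (intro exI[of _ "?P l"]) auto
    moreover have "1 \<in> set (?P l)" by (simp add: Pl f)
    ultimately show ?thesis by blast
  next
    case False
    \<comment> \<open>All partial products consist of zeros here, so two zeros amount to length
      two.\<close>
    obtain l where l: "0 < l" "length (?P 0) < length (?P l)" using longer by blast
    have "0 < length (?P 0)" using Pblock[of 0] by (auto simp: is_block_def)
    then have "2 \<le> length (?P l)" using l by linarith
    moreover have "\<forall>x\<in>set (?P l). x = 0" using False by (metis bit_not_zero_iff)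
    ultimately have "2 \<le> length (filter (\<lambda>x. x = 0) (?P l))" by (simp add: filter_id_conv)
    then have "extends [0] (?P l)"
      unfolding extends_def
      using length_cores_le[of "[0]" "?P l"] Pblock[of l] False
      by (intro exI[of _ "?P l"]) auto
    then show ?thesis using False by blast
  qed
  then obtain K where K: "extends [0] (?P K)" "(\<exists>l. 1 \<in> set (?P l)) \<longrightarrow> 1 \<in> set (?P K)" by blast
  obtain f where f: "f 0 = K" "\<And>i. f i < f (Suc i) \<and> length (?P (f i)) < length (?P (f (Suc i)))"
  proof -
    \<comment> \<open>Dependent choice selects partial products of strictly growing length, starting
      at \<open>K\<close>.\<close>
    have "\<exists>f. \<forall>i. (i = 0 \<longrightarrow> f i = K) \<and> f i < f (Suc i) \<and> length (?P (f i)) < length (?P (f (Suc i)))"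
      using dependent_nat_choice[of "\<lambda>i x. i = 0 \<longrightarrow> x = K"
          "\<lambda>i x y. x < y \<and> length (?P x) < length (?P y)"] longer by auto
    then show ?thesis using that by auto
  qed
  have fmono: "K \<le> f i" for i
    by (induction i) (use f in \<open>auto simp: less_imp_le intro: order.trans\<close>)
  have fone: "1 \<in> set (?P (f i))" if "1 \<in> set (?P l)" for i l
  proof (cases "K = f i")
    case True
    then show ?thesis using K that by auto
  next
    case False
    then have "K < f i" using fmono[of i] by simp
    then obtain c where "is_block c" "?P (f i) = ?P K \<boxtimes> c"
      using partial_times_factor[of b] block by blast
    then show ?thesis using K(2) that by (auto simp: is_block_iff)
  qed
  \<comment> \<open>The construction has to start with the word 0, so \<open>[0]\<close> is put in
    front of the chosen partial products.\<close>
  define A where "A i = (case i of 0 \<Rightarrow> [0] | Suc j \<Rightarrow> ?P (f j))" for i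
  have "extends (?P (f j)) (?P (f (Suc j)))" for j
  proof -
    obtain c where c: "is_block c" "?P (f (Suc j)) = ?P (f j) \<boxtimes> c" "2 \<le> length c"
      using factor f(2) by blast
    show ?thesis
    proof (cases "1 \<in> set (?P (f j))")
      case True
      then show ?thesis using extends_one Pblock c by simp
    next
      case False
      then have none: "1 \<notin> set (?P l)" for l using fone by blast
      have zero: "0 \<in> set (?P (f j))" using Pblock[of "f j"] by (auto simp: is_block_iff)
      \<comment> \<open>A 1 in \<open>c\<close> would produce a complemented copy and hence a 1 in
        the product. So \<open>c\<close> is all zeros, and every letter of it gives a copy with a
        core.\<close>
      have "1 \<in> set (a \<boxtimes> d)" if "1 \<in> set d" "0 \<in> set a" for a d
        using that by (induction d) auto
      then have "1 \<notin> set c" using none[of "f (Suc j)"] zero c(2) by auto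
      then have "\<forall>x\<in>set c. x = 0" by (metis bit_not_zero_iff)
      then have "2 \<le> length (filter (\<lambda>x. x = 0) c)" using c(3) by (simp add: filter_id_conv)
      then have "2 \<le> length (cores (?P (f j)) c)"
        using length_cores_le[OF zero, of c] by linarith
      then show ?thesis unfolding extends_def using c none by blast
    qed
  qed
  then have "extends (A i) (A (Suc i))" for i
    using K(1) f(1) by (cases i) (auto simp: A_def)
  moreover have "is_block (A i)" "initial_segment (A i) w" for i
  proof -
    show "is_block (A i)" using Pblock by (cases i) (auto simp: A_def is_block_def)
    obtain u where "?P 0 = 0 # u" using Pblock[of 0] by (auto simp: is_block_iff)
    then have "shd w = 0" using seg[of 0] by (auto simp: initial_segment_def)
    then show "initial_segment (A i) w"
      using seg by (cases i) (auto simp: A_def initial_segment_def)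
  qed
  ultimately show ?thesis
    by (intro spacer_rank_two_from_chain[of A]) (auto simp: A_def)
qed


section \<open>Periodic sequences of blocks\<close>

text \<open>Each letter is read off from a common prefix long enough to contain it.\<close>

lemma initial_segments_unique:
  assumes "filterlim (\<lambda>k. length (P k)) at_top sequentially"
    and "\<And>k. initial_segment (P k) v" "\<And>k. initial_segment (P k) w"
  shows "v = w"
proof -
  have "v !! n = w !! n" for n
  proof -
    have "\<forall>\<^sub>F k in sequentially. Suc n \<le> length (P k)"
      using assms(1) by (auto simp: filterlim_at_top)
    then obtain k where k: "n < length (P k)"
      by (auto simp: eventually_sequentially Suc_le_eq)
    have "v !! n = P k ! n" "w !! n = P k ! n"
      using assms(2,3)[of k] stake_nth[OF k] by (metis initial_segment_def)+
    then show ?thesis by simp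
  qed
  then have "smap id v = w" by (simp add: smap_alt)
  then show ?thesis by (simp add: stream.map_id)
qed

definition Morse_substitution :: "word \<Rightarrow> bit \<Rightarrow> word" where
  "Morse_substitution a x = (if x = 0 then a else compl_word a)"

lemma subst_word_Morse [simp]: "subst_word (Morse_substitution a) u = a \<boxtimes> u"
  by (simp add: subst_word_def word_times_def Morse_substitution_def [abs_def])

text \<open>The images of both letters have length \<open>length a\<close>, so the n-th iterate on 1
  has length \<open>length a ^ n\<close>, which exceeds n.\<close>

lemma substitution_Morse:
  assumes "is_block a" "1 < length a"
  shows "substitution (Morse_substitution a)"
proof -
  have "length ((subst_word (Morse_substitution a) ^^ n) [1]) = length a ^ n" for n
    by (induction n) auto
  moreover have "filterlim (\<lambda>n. length a ^ n) at_top sequentially"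
    unfolding filterlim_at_top
  proof
    fix Z
    have "Z \<le> length a ^ n" if "Z \<le> n" for n
      using that power_gt_expt[of "length a" n] assms(2) by linarith
    then show "\<forall>\<^sub>F n in sequentially. Z \<le> length a ^ n"
      by (auto simp: eventually_sequentially)
  qed
  ultimately show ?thesis
    using assms by (simp add: substitution_def Morse_substitution_def is_block_def)
qed

lemma flat_shift: "[] \<notin> sset s \<Longrightarrow> [] \<notin> set us \<Longrightarrow> flat (us @- s) = concat us @- flat s"
  by (induction us) (auto simp: flat_unfold)

text \<open>\<open>partial_times b q\<close> has \<open>Suc q\<close> factors, one full period. By
  periodicity the factors after it repeat \<open>b 0\<close> to \<open>b k\<close>, and
  associativity splits the product there.\<close>

lemma partial_times_period:
  assumes "\<And>i. b (i + Suc q) = b i"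
  shows "partial_times b (k + Suc q) = partial_times b q \<boxtimes> partial_times b k"
proof (induction k)
  case 0
  then show ?case using assms[of 0] by simp
next
  case (Suc k)
  then show ?case using assms[of "Suc k"] by (simp add: word_times_assoc)
qed

lemma periodic_Morse_fixed_point:
  assumes M: "Morse_expansion w b" and "periodic b"
  shows "\<exists>\<zeta>. substitution \<zeta> \<and> fixed_point \<zeta> w"
proof -
  let ?P = "partial_times b"
  have block: "is_block (?P k)" and seg: "initial_segment (?P k) w" for k
    using M is_block_partial_times by (auto simp: Morse_expansion_def)
  have lim: "filterlim (\<lambda>k. length (?P k)) at_top sequentially"
    using M by (simp add: Morse_expansion_def)
  obtain p where "p > 0" "\<And>i. b (i + p) = b i"
    using \<open>periodic b\<close> by (auto simp: periodic_def)
  then obtain q where "\<And>i. b (i + Suc q) = b i" by (metis gr0_implies_Suc)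
  note period = partial_times_period[of b q, OF this]
  define a where "a = ?P q"
  have a: "is_block a" by (simp add: a_def block)
  have lim': "filterlim (\<lambda>k. length (?P (k + Suc q))) at_top sequentially"
    by (rule filterlim_compose[OF lim filterlim_add_const_nat_at_top])
  \<comment> \<open>If a full period multiplied to a single letter, moving on by one period would
    not change the length of a partial product. The index \<open>N * Suc q\<close> then lies beyond
    \<open>N\<close> but gives only the length of \<open>?P 0\<close>.\<close>
  have "1 < length a"
  proof (rule ccontr)
    assume "\<not> 1 < length a"
    moreover have "a \<noteq> []" using a by (simp add: is_block_def)
    ultimately have one: "length a = 1" by (cases a) auto
    have same: "length (?P (k + n * Suc q)) = length (?P k)" for k n
    proof (induction n)
      case (Suc n)
      have "k + Suc n * Suc q = (k + n * Suc q) + Suc q" by simp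
      then show ?case using Suc one period by (metis a_def length_word_times mult_1)
    qed simp
    have "\<forall>\<^sub>F k in sequentially. Suc (length (?P 0)) \<le> length (?P k)"
      using lim by (auto simp: filterlim_at_top)
    then obtain N where "\<And>k. N \<le> k \<Longrightarrow> Suc (length (?P 0)) \<le> length (?P k)"
      by (auto simp: eventually_sequentially)
    from this[of "0 + N * Suc q"] show False unfolding same by simp
  qed
  then have sub: "substitution (Morse_substitution a)" using substitution_Morse a by blast
  let ?\<zeta> = "Morse_substitution a"
  have nonempty: "?\<zeta> x \<noteq> []" for x
    using a by (auto simp: Morse_substitution_def is_block_iff)
  \<comment> \<open>The substitution sends the prefix \<open>?P k\<close> of w to
    \<open>?P (k + Suc q)\<close>, which therefore begins the image of w.\<close>
  have "initial_segment (?P (k + Suc q)) (flat (smap ?\<zeta> w))" for k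
  proof -
    define n where "n = length (?P k)"
    have w: "w = ?P k @- sdrop n w"
      using seg[of k] unfolding initial_segment_def n_def by (metis stake_sdrop)
    have "flat (smap ?\<zeta> w) = flat (map ?\<zeta> (?P k) @- smap ?\<zeta> (sdrop n w))"
      by (subst w) (simp only: smap_shift)
    also have "\<dots> = concat (map ?\<zeta> (?P k)) @- flat (smap ?\<zeta> (sdrop n w))"
      by (rule flat_shift) (use nonempty in \<open>auto simp: stream.set_map image_iff dest: sym\<close>)
    also have "concat (map ?\<zeta> (?P k)) = ?P (k + Suc q)"
      using period[of k] subst_word_Morse[of a "?P k"] by (simp add: subst_word_def a_def)
    finally show ?thesis by (simp add: initial_segment_def stake_shift)
  qed
  \<comment> \<open>Both w and its image begin with all the words \<open>?P (k + Suc q)\<close>,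
    whose lengths tend to infinity.\<close>
  then have "flat (smap ?\<zeta> w) = w"
    using initial_segments_unique[OF lim'] seg by blast
  moreover obtain u where "?P 0 = 0 # u" using block[of 0] by (auto simp: is_block_iff)
  then have "shd w = 0" using seg[of 0] by (auto simp: initial_segment_def)
  ultimately show ?thesis using sub by (auto simp: fixed_point_def)
qed

theorem proposition3p32:
  fixes w :: "bit stream"
  assumes "generalized_Morse w"
  shows "at_most_spacer_rank_two w \<and>
    (\<forall>b. Morse_expansion w b \<and> periodic b \<longrightarrow> (\<exists>\<zeta>. substitution \<zeta> \<and> fixed_point \<zeta> w))"
  using assms generalized_Morse_rank_two periodic_Morse_fixed_point
  unfolding generalized_Morse_def by blast

end
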